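(* Let $I\subseteq[0,\infty)$ be a closed interval of positive length, and let $\{X_1(t),\,t\geq 0\}$ and $\{X_2(t),\,t\geq 0\}$ be self-similar processes with stationary increments and parameters $H_1,H_2\in(0,1)$, respectively, both with finite absolute moment and having sample paths in $C(I)$ almost surely, such that neither the distribution of $X_1(1)$ nor that of $X_2(1)$ has an atom at zero. Then $H_1\neq H_2$ implies that $X_1$ and $X_2$ are singular on $I$, i.e. $X_1\,\bot\,X_2$.
   Context: Let $\alpha>0$. A real-valued process $\{X(t),t\geq 0\}$ starting from zero ($X(0)=0$) is called $\alpha$-self-similar (self-similar with parameter $\alpha$) if it is not identically zero and for all $T>0$ the processes $X(T\,\cdot\,)$ and $T^\alpha X(\,\cdot\,)$ have the same finite-dimensional distributions. In the stationary increments case the parameter is denoted by $H$. Stationary increments means that for every $s\ge0$ the processes $\{X(t+s)-X(s),t\ge0\}$ and $\{X(t)-X(0),t\ge0\}$ have the same finite-dimensional distributions. Finite absolute moment means $\mathsf{E}|X(t)|<\infty$ for all $t\ge0$. $C(I)$ denotes the set of continuous real functions on the closed interval $I\subseteq[0,\infty)$ with the local uniform topology and Borel $\sigma$-algebra $\mathcal{B}(C(I))$. If $\{X_1(t),t\in I\}$ and $\{X_2(t),t\in I\}$ have sample paths in $C(I)$ a.s., they are called singular on $I$ ($X_1\,\bot\,X_2$) if their distributions $\mathsf{P}_{X_1},\mathsf{P}_{X_2}$ on $(C(I),\mathcal{B}(C(I)))$ are singular, i.e. there is $A\in\mathcal{B}(C(I))$ with $\mathsf{P}_{X_1}(A)=1$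 and $\mathsf{P}_{X_2}(A)=0$. *)

theory Defs
  imports "HOL-Probability.Probability"
begin

section \<open>Processes indexed by the nonnegative reals\<close>

text \<open>
  A process on \<open>M\<close> is a family \<open>X :: real \<Rightarrow> 'a \<Rightarrow> real\<close>; only the time points \<open>t \<ge> 0\<close> are
  constrained, the values of \<open>X\<close> at negative times are irrelevant everywhere below.
\<close>

definition real_process :: "'a measure \<Rightarrow> (real \<Rightarrow> 'a \<Rightarrow> real) \<Rightarrow> bool" where
  "real_process M X \<longleftrightarrow> prob_space M \<and> (\<forall>t\<ge>0. X t \<in> borel_measurable M)"

definition same_fdd :: "'a measure \<Rightarrow> (real \<Rightarrow> 'a \<Rightarrow> real) \<Rightarrow> 'b measure \<Rightarrow> (real \<Rightarrow> 'b \<Rightarrow> real) \<Rightarrow> bool" where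
  "same_fdd M X N Y \<longleftrightarrow>
     (\<forall>J. finite J \<and> J \<subseteq> {0..} \<longrightarrow>
        distr M (PiM J (\<lambda>_. borel)) (\<lambda>\<omega>. \<lambda>t\<in>J. X t \<omega>) =
        distr N (PiM J (\<lambda>_. borel)) (\<lambda>\<omega>. \<lambda>t\<in>J. Y t \<omega>))"

text \<open>
  Starting from zero and being identically zero are understood up to null sets.
\<close>

definition self_similar :: "'a measure \<Rightarrow> real \<Rightarrow> (real \<Rightarrow> 'a \<Rightarrow> real) \<Rightarrow> bool" where
  "self_similar M \<alpha> X \<longleftrightarrow>
     real_process M X \<and> \<alpha> > 0 \<and>
     (AE \<omega> in M. X 0 \<omega> = 0) \<and>
     (\<exists>t\<ge>0. \<not> (AE \<omega> in M. X t \<omega> = 0)) \<and>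
     (\<forall>T>0. same_fdd M (\<lambda>t. X (T * t)) M (\<lambda>t \<omega>. T powr \<alpha> * X t \<omega>))"

definition stationary_increments :: "'a measure \<Rightarrow> (real \<Rightarrow> 'a \<Rightarrow> real) \<Rightarrow> bool" where
  "stationary_increments M X \<longleftrightarrow>
     (\<forall>s\<ge>0. same_fdd M (\<lambda>t \<omega>. X (t + s) \<omega> - X s \<omega>) M (\<lambda>t \<omega>. X t \<omega> - X 0 \<omega>))"

definition finite_absolute_moment :: "'a measure \<Rightarrow> (real \<Rightarrow> 'a \<Rightarrow> real) \<Rightarrow> bool" where
  "finite_absolute_moment M X \<longleftrightarrow> (\<forall>t\<ge>0. integrable M (X t))"

section \<open>The space of continuous functions on an interval\<close>

text \<open>
  Functions on \<open>I\<close> are represented by total functions that are \<^const>\<open>undefined\<close> off \<open>I\<close>, so that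
  two elements are equal iff they agree on \<open>I\<close>.
\<close>

definition cont_funs :: "real set \<Rightarrow> (real \<Rightarrow> real) set" where
  "cont_funs I = {f \<in> extensional I. continuous_on I f}"

definition loc_unif_nhd :: "real set \<Rightarrow> (real \<Rightarrow> real) \<Rightarrow> real set \<Rightarrow> real \<Rightarrow> (real \<Rightarrow> real) set" where
  "loc_unif_nhd I f K e = {g \<in> cont_funs I. \<forall>t\<in>K. dist (g t) (f t) < e}"

definition loc_unif_topology :: "real set \<Rightarrow> (real \<Rightarrow> real) topology" where
  "loc_unif_topology I = topology (\<lambda>U. U \<subseteq> cont_funs I \<and>
     (\<forall>f\<in>U. \<exists>K e. compact K \<and> K \<subseteq> I \<and> e > 0 \<and> loc_unif_nhd I f K e \<subseteq> U))"

lemma openin_loc_unif_topology: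
  "openin (loc_unif_topology I) U \<longleftrightarrow> U \<subseteq> cont_funs I \<and>
     (\<forall>f\<in>U. \<exists>K e. compact K \<and> K \<subseteq> I \<and> e > 0 \<and> loc_unif_nhd I f K e \<subseteq> U)"
proof -
  have "istopology (\<lambda>U. U \<subseteq> cont_funs I \<and>
     (\<forall>f\<in>U. \<exists>K e. compact K \<and> K \<subseteq> I \<and> e > 0 \<and> loc_unif_nhd I f K e \<subseteq> U))"
    (is "istopology ?P")
    unfolding istopology_def
  proof (intro conjI allI impI)
    fix S T assume S: "?P S" and T: "?P T"
    have "\<exists>K e. compact K \<and> K \<subseteq> I \<and> e > 0 \<and> loc_unif_nhd I f K e \<subseteq> S \<inter> T"
      if f: "f \<in> S \<inter> T" for f
    proof -
      obtain K e where K: "compact K" "K \<subseteq> I" "e > 0" "loc_unif_nhd I f K e \<subseteq> S"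
        using bspec[OF conjunct2[OF S] IntD1[OF f]] by (elim exE conjE)
      obtain L d where L: "compact L" "L \<subseteq> I" "d > 0" "loc_unif_nhd I f L d \<subseteq> T"
        using bspec[OF conjunct2[OF T] IntD2[OF f]] by (elim exE conjE)
      have "loc_unif_nhd I f (K \<union> L) (min e d) \<subseteq> loc_unif_nhd I f K e \<inter> loc_unif_nhd I f L d"
        by (auto simp: loc_unif_nhd_def)
      then show ?thesis
        using K L by (intro exI[of _ "K \<union> L"] exI[of _ "min e d"]) auto
    qed
    then show "\<forall>f\<in>S \<inter> T. \<exists>K e. compact K \<and> K \<subseteq> I \<and> e > 0 \<and> loc_unif_nhd I f K e \<subseteq> S \<inter> T"
      by (rule ballI)
    show "S \<inter> T \<subseteq> cont_funs I"
      using conjunct1[OF S] by (rule le_infI1)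
  next
    fix \<K> assume P: "\<forall>S\<in>\<K>. ?P S"
    show "\<Union>\<K> \<subseteq> cont_funs I"
      using P by (intro Union_least) simp
    show "\<forall>f\<in>\<Union>\<K>. \<exists>K e. compact K \<and> K \<subseteq> I \<and> e > 0 \<and> loc_unif_nhd I f K e \<subseteq> \<Union>\<K>"
    proof
      fix f assume "f \<in> \<Union>\<K>"
      then obtain S where S: "S \<in> \<K>" "f \<in> S" by (rule UnionE)
      obtain K e where K: "compact K" "K \<subseteq> I" "e > 0" "loc_unif_nhd I f K e \<subseteq> S"
        using bspec[OF conjunct2[OF bspec[OF P S(1)]] S(2)] by (elim exE conjE)
      have "S \<subseteq> \<Union>\<K>"
        using S(1) by (rule Union_upper)
      with K show "\<exists>K e. compact K \<and> K \<subseteq> I \<and> e > 0 \<and> loc_unif_nhd I f K e \<subseteq> \<Union>\<K>"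
        by (intro exI[of _ K] exI[of _ e]) simp
    qed
  qed
  then show ?thesis
    unfolding loc_unif_topology_def by (simp add: topology_inverse')
qed

lemma topspace_loc_unif_topology: "topspace (loc_unif_topology I) = cont_funs I"
proof
  show "topspace (loc_unif_topology I) \<subseteq> cont_funs I"
    using openin_topspace[of "loc_unif_topology I"] by (simp only: openin_loc_unif_topology)
  have "openin (loc_unif_topology I) (cont_funs I)"
    unfolding openin_loc_unif_topology
  proof (intro conjI ballI)
    fix f
    have "compact ({} :: real set) \<and> {} \<subseteq> I \<and> (1::real) > 0 \<and> loc_unif_nhd I f {} 1 \<subseteq> cont_funs I"
      by (simp add: loc_unif_nhd_def)
    then show "\<exists>K e. compact K \<and> K \<subseteq> I \<and> e > 0 \<and> loc_unif_nhd I f K e \<subseteq> cont_funs I"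
      by blast
  qed simp
  then show "cont_funs I \<subseteq> topspace (loc_unif_topology I)"
    by (rule openin_subset)
qed

definition borel_cont_funs :: "real set \<Rightarrow> (real \<Rightarrow> real) measure" where
  "borel_cont_funs I = sigma (cont_funs I) {U. openin (loc_unif_topology I) U}"

section \<open>Path distributions and singularity\<close>

text \<open>
  If the sample paths on \<open>I\<close> are only almost surely continuous, the path map has to be redefined on
  the exceptional set; the zero function used there does not influence the distribution. As the set
  of discontinuous paths is contained in a null set but need not be measurable itself, the
  distribution is formed over the completion of \<open>M\<close>.
\<close>

definition sample_paths_in_C :: "'a measure \<Rightarrow> (real \<Rightarrow> 'a \<Rightarrow> real) \<Rightarrow> real set \<Rightarrow> bool" where
  "sample_paths_in_C M X I \<longleftrightarrow> (AE \<omega> in M. continuous_on I (\<lambda>t. X t \<omega>))"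

definition path_map :: "real set \<Rightarrow> (real \<Rightarrow> 'a \<Rightarrow> real) \<Rightarrow> 'a \<Rightarrow> real \<Rightarrow> real" where
  "path_map I X \<omega> =
     (if continuous_on I (\<lambda>t. X t \<omega>) then (\<lambda>t\<in>I. X t \<omega>) else (\<lambda>t\<in>I. 0))"

definition path_law :: "'a measure \<Rightarrow> real set \<Rightarrow> (real \<Rightarrow> 'a \<Rightarrow> real) \<Rightarrow> (real \<Rightarrow> real) measure" where
  "path_law M I X = distr (completion M) (borel_cont_funs I) (path_map I X)"

definition singular_on ::
    "real set \<Rightarrow> 'a measure \<Rightarrow> (real \<Rightarrow> 'a \<Rightarrow> real) \<Rightarrow> 'b measure \<Rightarrow> (real \<Rightarrow> 'b \<Rightarrow> real) \<Rightarrow> bool" where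
  "singular_on I M1 X1 M2 X2 \<longleftrightarrow>
     (\<exists>A\<in>sets (borel_cont_funs I).
        emeasure (path_law M1 I X1) A = 1 \<and> emeasure (path_law M2 I X2) A = 0)"

end

theory Submission
  imports Defs
begin

text \<open>
  Let \<open>\<gamma>\<close> lie strictly between the two parameters, divide \<open>[a, b] \<subseteq> I\<close> into \<open>2 ^ j\<close> pieces of length
  \<open>h\<close>, and consider the event that the mean absolute increment over the pieces is at most
  \<open>h powr \<gamma> / 2\<close>. Each increment is distributed as \<open>h powr H * X 1\<close>. If \<open>H > \<gamma>\<close>, Markov's inequality
  bounds the probability of the complement by a multiple of \<open>h powr (H - \<gamma>)\<close>, which is summable in
  \<open>j\<close>, so by Borel-Cantelli the event occurs eventually. If \<open>H < \<gamma>\<close>, the event forces at least half of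
  the increments to be at most \<open>h powr \<gamma>\<close> in absolute value; by Markov's inequality for their number
  this has probability at most twice that of \<open>\<bar>X 1\<bar> \<le> h powr (\<gamma> - H)\<close>, which tends to \<open>0\<close> as \<open>X 1\<close>
  has no atom at zero.
\<close>

section \<open>Measurability of maps into the path space\<close>

text \<open>
  Boxes over finitely many members of a countable basis, with rational centres and radii, form a
  countable family that is fine enough to generate all locally uniformly open sets. They take the
  place of a countable dense subset of \<open>C(I)\<close>.
\<close>

definition cont_box :: "real set \<Rightarrow> (real set \<times> real \<times> real) set \<Rightarrow> (real \<Rightarrow> real) set" where
  "cont_box I F = {g \<in> cont_funs I. \<forall>(W, q, r)\<in>F. \<forall>t\<in>I \<inter> W. dist (g t) q \<le> r}"

text \<open>The condition \<open>dist (g x) q \<le> r\<close> is closed, so by continuity it passes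
  to limits of points of \<open>T\<close>. This replaces an uncountable quantifier over
  \<open>S\<close> by one over a dense subset.\<close>

lemma dist_le_closure:
  fixes g :: "real \<Rightarrow> real"
  assumes "continuous_on S g" "T \<subseteq> S" "S \<subseteq> closure T" "\<And>t. t \<in> T \<Longrightarrow> dist (g t) q \<le> r" "x \<in> S"
  shows "dist (g x) q \<le> r"
proof -
  obtain y where y: "\<And>n. y n \<in> T" "y \<longlonglongrightarrow> x"
    using subsetD[OF assms(3,5)] unfolding closure_sequential by blast
  then have "(\<lambda>n. g (y n)) \<longlonglongrightarrow> g x"
    using subsetD[OF assms(2)] by (intro continuous_on_tendsto_compose[OF assms(1) _ assms(5)]) auto
  then have "(\<lambda>n. dist (g (y n)) q) \<longlonglongrightarrow> dist (g x) q"
    by (intro tendsto_intros)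
  then show ?thesis
    by (rule LIMSEQ_le_const2) (use assms(4) y in auto)
qed

text \<open>By continuity of each \<open>f \<omega>\<close>, every condition of a box need only be
  tested on a countable dense subset of \<open>I \<inter> W\<close>. What remains is a finite
  conjunction of countable intersections of measurable sets.\<close>

lemma cont_box_preimage_measurable:
  assumes f: "f \<in> space N \<rightarrow> cont_funs I"
    and meas: "\<And>t. t \<in> I \<Longrightarrow> (\<lambda>\<omega>. f \<omega> t) \<in> borel_measurable N"
    and "finite F"
  shows "f -` cont_box I F \<inter> space N \<in> sets N"
proof -
  have piece: "{\<omega> \<in> space N. \<forall>t\<in>I \<inter> W. dist (f \<omega> t) q \<le> r} \<in> sets N" for W q r
  proof -
    obtain T where T: "countable T" "T \<subseteq> I \<inter> W" "I \<inter> W \<subseteq> closure T"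
      using separable[of "I \<inter> W"] by blast
    have "(\<forall>t\<in>I \<inter> W. dist (f \<omega> t) q \<le> r) \<longleftrightarrow> (\<forall>t\<in>T. dist (f \<omega> t) q \<le> r)"
      if "\<omega> \<in> space N" for \<omega>
    proof -
      have "continuous_on (I \<inter> W) (f \<omega>)"
        using f that by (auto simp: cont_funs_def intro: continuous_on_subset)
      then show ?thesis
        using T dist_le_closure by (meson subsetD)
    qed
    then have "{\<omega> \<in> space N. \<forall>t\<in>I \<inter> W. dist (f \<omega> t) q \<le> r}
        = {\<omega> \<in> space N. \<forall>t\<in>T. dist (f \<omega> t) q \<le> r}"
      by blast
    moreover have "{\<omega> \<in> space N. dist (f \<omega> t) q \<le> r} \<in> sets N" if "t \<in> T" for t
    proof -
      have [measurable]: "(\<lambda>\<omega>. f \<omega> t) \<in> borel_measurable N"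
        using that T(2) meas by blast
      show ?thesis
        by measurable
    qed
    then have "{\<omega> \<in> space N. \<forall>t\<in>T. dist (f \<omega> t) q \<le> r} \<in> sets N"
      by (rule sets.sets_Collect_countable_All'[OF _ T(1)])
    ultimately show ?thesis
      by simp
  qed
  have "f -` cont_box I F \<inter> space N =
      {\<omega> \<in> space N. \<forall>p\<in>F. \<forall>t\<in>I \<inter> fst p. dist (f \<omega> t) (fst (snd p)) \<le> snd (snd p)}"
    using f by (auto simp: cont_box_def split_beta)
  also have "\<dots> \<in> sets N"
    by (rule sets.sets_Collect_finite_All[OF _ \<open>finite F\<close>]) (rule piece)
  finally show ?thesis .
qed

text \<open>Around each point of \<open>K\<close> some basis set \<open>W\<close> keeps
  \<open>f\<close> within \<open>r\<close> of a rational \<open>q\<close>. Compactness selects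
  finitely many of these sets, and the triangle inequality through \<open>q\<close> compares any
  \<open>g\<close> in the resulting box with \<open>f\<close> on \<open>K\<close>.\<close>

lemma cont_box_nhd:
  assumes "topological_basis B" and f: "f \<in> cont_funs I" and K: "compact K" "K \<subseteq> I" and "e > 0"
  obtains F where "finite F" "F \<subseteq> B \<times> \<rat> \<times> \<rat>" "f \<in> cont_box I F" "cont_box I F \<subseteq> loc_unif_nhd I f K e"
proof -
  have cont: "continuous_on I f"
    using f by (simp add: cont_funs_def)
  \<comment> \<open>\<open>g s\<close> and \<open>f s\<close> will each be within \<open>r\<close>
    of the same centre, so \<open>2 * r < e\<close> yields the strict bound.\<close>
  obtain r where r: "r \<in> \<rat>" "0 < r" "2 * r < e"
    using Rats_dense_in_real[of 0 "e / 2"] \<open>e > 0\<close> by auto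
  have "\<exists>W q. W \<in> B \<and> q \<in> \<rat> \<and> t \<in> W \<and> (\<forall>s\<in>I \<inter> W. dist (f s) q \<le> r)" if t: "t \<in> K" for t
  proof -
    \<comment> \<open>Half of \<open>r\<close> is spent on the distance from \<open>q\<close> to
      \<open>f t\<close>, the other half on the oscillation of \<open>f\<close> near
      \<open>t\<close>.\<close>
    obtain q where q: "q \<in> \<rat>" "f t - r / 2 < q" "q < f t"
      using Rats_dense_in_real[of "f t - r / 2" "f t"] r by auto
    obtain V where V: "open V" "t \<in> V" "\<forall>s\<in>I. s \<in> V \<longrightarrow> f s \<in> ball (f t) (r / 2)"
      using cont[unfolded continuous_on_topological, rule_format, of t "ball (f t) (r / 2)"] t K(2) r
      by auto
    obtain W where W: "W \<in> B" "t \<in> W" "W \<subseteq> V"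
      using topological_basisE[OF assms(1) V(1,2)] by blast
    have "dist (f s) q \<le> r" if "s \<in> I \<inter> W" for s
    proof -
      have "f s \<in> ball (f t) (r / 2)"
        using that V(3) W(3) by blast
      then show ?thesis
        using q unfolding mem_ball dist_real_def by linarith
    qed
    then show ?thesis
      using W q by blast
  qed
  then obtain W q where Wq: "\<And>t. t \<in> K \<Longrightarrow> W t \<in> B \<and> q t \<in> \<rat> \<and> t \<in> W t \<and>
      (\<forall>s\<in>I \<inter> W t. dist (f s) (q t) \<le> r)"
    by metis
  have "open (W t)" if "t \<in> K" for t
    using Wq[OF that] assms(1) by (simp add: topological_basis_open)
  moreover have "K \<subseteq> (\<Union>t\<in>K. W t)"
    using Wq by blast
  ultimately obtain D where D: "D \<subseteq> K" "finite D" "K \<subseteq> (\<Union>t\<in>D. W t)"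
    using compactE_image[OF K(1)] by metis
  define F where "F = (\<lambda>t. (W t, q t, r)) ` D"
  show thesis
  proof (rule that)
    show "finite F"
      using D by (simp add: F_def)
    show "F \<subseteq> B \<times> \<rat> \<times> \<rat>"
      using D Wq r by (auto simp: F_def)
    show "f \<in> cont_box I F"
      using f D Wq by (auto simp: F_def cont_box_def)
    show "cont_box I F \<subseteq> loc_unif_nhd I f K e"
    proof
      fix g assume g: "g \<in> cont_box I F"
      have "dist (g s) (f s) < e" if s: "s \<in> K" for s
      proof -
        obtain t where t: "t \<in> D" "s \<in> W t"
          using s D by blast
        have "dist (g s) (q t) \<le> r"
          using g t s K(2) by (auto simp: cont_box_def F_def)
        moreover have "dist (f s) (q t) \<le> r"
          using Wq t s K(2) D(1) by blast
        ultimately show ?thesis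
          using r(3) dist_triangle2[of "g s" "f s" "q t"] by linarith
      qed
      then show "g \<in> loc_unif_nhd I f K e"
        using g by (simp add: loc_unif_nhd_def cont_box_def)
    qed
  qed
qed

lemma space_borel_cont_funs: "space (borel_cont_funs I) = cont_funs I"
  unfolding borel_cont_funs_def
  by (rule space_measure_of) (use openin_subset topspace_loc_unif_topology in blast)

text \<open>Every locally uniformly open set is the union of the boxes it contains, and only
  countably many boxes exist. Hence measurability of all evaluations already gives measurability for
  the Borel sets of the path space.\<close>

lemma measurable_borel_cont_funs:
  assumes f: "f \<in> space N \<rightarrow> cont_funs I"
    and meas: "\<And>t. t \<in> I \<Longrightarrow> (\<lambda>\<omega>. f \<omega> t) \<in> borel_measurable N"
  shows "f \<in> measurable N (borel_cont_funs I)"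
  unfolding borel_cont_funs_def
proof (rule measurable_measure_of)
  show "{U. openin (loc_unif_topology I) U} \<subseteq> Pow (cont_funs I)"
    using openin_subset topspace_loc_unif_topology by blast
  fix U assume "U \<in> {U. openin (loc_unif_topology I) U}"
  then have U: "U \<subseteq> cont_funs I"
    "\<And>g. g \<in> U \<Longrightarrow> \<exists>K e. compact K \<and> K \<subseteq> I \<and> e > 0 \<and> loc_unif_nhd I g K e \<subseteq> U"
    by (auto simp: openin_loc_unif_topology)
  obtain B :: "real set set" where B: "countable B" "topological_basis B"
    using ex_countable_basis by blast
  define \<F> where "\<F> = {F. finite F \<and> F \<subseteq> B \<times> \<rat> \<times> \<rat>} \<inter> {F. cont_box I F \<subseteq> U}"
  have "countable \<F>"
    unfolding \<F>_def using B(1) countable_rat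
    by (intro countable_Int1 countable_Collect_finite_subset countable_SIGMA) auto
  moreover have "f -` U \<inter> space N = (\<Union>F\<in>\<F>. f -` cont_box I F \<inter> space N)"
  proof -
    have "\<exists>F\<in>\<F>. g \<in> cont_box I F" if g: "g \<in> U" for g
    proof -
      obtain K e where K: "compact K" "K \<subseteq> I" "e > 0" and nhd: "loc_unif_nhd I g K e \<subseteq> U"
        using U(2)[OF g] by (elim exE conjE)
      have "g \<in> cont_funs I"
        using U(1) g by (rule subsetD)
      then obtain F where "finite F" "F \<subseteq> B \<times> \<rat> \<times> \<rat>" "g \<in> cont_box I F"
        "cont_box I F \<subseteq> loc_unif_nhd I g K e"
        using cont_box_nhd[OF B(2) _ K] by metis
      then show ?thesis
        using nhd unfolding \<F>_def by (intro bexI[of _ F]) auto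
    qed
    moreover have "cont_box I F \<subseteq> U" if "F \<in> \<F>" for F
      using that by (simp add: \<F>_def)
    ultimately have "U = (\<Union>F\<in>\<F>. cont_box I F)"
      by blast
    then have "f -` U = (\<Union>F\<in>\<F>. f -` cont_box I F)"
      by (metis vimage_UN)
    then show ?thesis
      by (simp only: Int_UN_distrib2 UN_simps)
  qed
  ultimately show "f -` U \<inter> space N \<in> sets N"
    using cont_box_preimage_measurable[OF f meas]
    by (simp only:) (intro sets.countable_UN', auto simp: \<F>_def)
qed (use f in auto)

text \<open>Evaluation at \<open>t\<close> is continuous for the local uniform topology: the compact
  set \<open>{t}\<close> alone controls the value.\<close>

lemma borel_measurable_eval [measurable (raw)]:
  assumes "t \<in> I"
  shows "(\<lambda>f. f t) \<in> borel_measurable (borel_cont_funs I)"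
proof (rule borel_measurableI)
  fix S :: "real set" assume "open S"
  have "openin (loc_unif_topology I) ((\<lambda>f. f t) -` S \<inter> cont_funs I)"
    unfolding openin_loc_unif_topology
  proof (intro conjI ballI)
    fix f assume "f \<in> (\<lambda>f. f t) -` S \<inter> cont_funs I"
    then obtain e where "e > 0" "ball (f t) e \<subseteq> S"
      using \<open>open S\<close> openE by blast
    then have "compact {t} \<and> {t} \<subseteq> I \<and> e > 0 \<and>
        loc_unif_nhd I f {t} e \<subseteq> (\<lambda>f. f t) -` S \<inter> cont_funs I"
      using assms by (auto simp: loc_unif_nhd_def dist_commute subset_iff)
    then show "\<exists>K e. compact K \<and> K \<subseteq> I \<and> e > 0 \<and>
        loc_unif_nhd I f K e \<subseteq> (\<lambda>f. f t) -` S \<inter> cont_funs I"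
      by blast
  qed auto
  then show "(\<lambda>f. f t) -` S \<inter> space (borel_cont_funs I) \<in> sets (borel_cont_funs I)"
    unfolding space_borel_cont_funs
    by (auto simp: borel_cont_funs_def intro!: in_measure_of)
       (use openin_subset topspace_loc_unif_topology in blast)
qed

section \<open>Laws of sample paths\<close>

lemma path_map_in_cont_funs: "path_map I X \<omega> \<in> cont_funs I"
proof -
  have "continuous_on I (\<lambda>t\<in>I. Y t)" if "continuous_on I Y" for Y :: "real \<Rightarrow> real"
    using that by (rule continuous_on_eq) simp
  then show ?thesis
    by (auto simp: path_map_def cont_funs_def)
qed

lemma measurable_path_map:
  assumes X: "real_process M X" and I: "I \<subseteq> {0..}" and cont: "sample_paths_in_C M X I"
  shows "path_map I X \<in> measurable (completion M) (borel_cont_funs I)"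
proof (rule measurable_borel_cont_funs)
  fix t assume t: "t \<in> I"
  have [measurable]: "X t \<in> borel_measurable (completion M)"
    using X I t by (auto simp: real_process_def intro!: measurable_completion)
  \<comment> \<open>The discontinuous paths lie in a null set, hence form a measurable set in the
    completion; negating once more gives measurability of the case distinction in
    \<open>path_map\<close>.\<close>
  have "Measurable.pred (completion M) (\<lambda>\<omega>. \<not> continuous_on I (\<lambda>t. X t \<omega>))"
    using cont by (intro sets_completion_AE) (simp add: sample_paths_in_C_def)
  from pred_intros_logic(2)[OF this]
  have [measurable]: "Measurable.pred (completion M) (\<lambda>\<omega>. continuous_on I (\<lambda>t. X t \<omega>))"
    by simp
  have "(\<lambda>\<omega>. path_map I X \<omega> t) = (\<lambda>\<omega>. if continuous_on I (\<lambda>t. X t \<omega>) then X t \<omega> else 0)"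
    using t by (auto simp: path_map_def)
  then show "(\<lambda>\<omega>. path_map I X \<omega> t) \<in> borel_measurable (completion M)"
    by simp
qed (simp add: path_map_in_cont_funs)

lemma space_path_law: "space (path_law M I X) = cont_funs I"
  by (simp add: path_law_def space_borel_cont_funs)

lemma prob_space_path_law:
  assumes "real_process M X" "I \<subseteq> {0..}" "sample_paths_in_C M X I"
  shows "prob_space (path_law M I X)"
  unfolding path_law_def
  using assms by (intro prob_space.prob_space_distr prob_space.prob_space_completion measurable_path_map)
    (simp_all add: real_process_def)

section \<open>Laws of increments\<close>

lemma distr_one_dim_marginal:
  assumes [measurable]: "X t \<in> borel_measurable M"
  shows "distr (distr M (PiM {t} (\<lambda>_. borel)) (\<lambda>\<omega>. \<lambda>u\<in>{t}. X u \<omega>)) borel (\<lambda>f. f t) = distr M borel (X t)"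
proof -
  have "(\<lambda>\<omega>. \<lambda>u\<in>{t}. X u \<omega>) \<in> measurable M (PiM {t} (\<lambda>_. borel))"
    by (rule measurable_restrict) auto
  then show ?thesis
    by (subst distr_distr) (auto simp: comp_def)
qed

lemma same_fdd_distr_eq:
  assumes "same_fdd M X N Y" "t \<ge> 0" "X t \<in> borel_measurable M" "Y t \<in> borel_measurable N"
  shows "distr M borel (X t) = distr N borel (Y t)"
proof -
  have "distr M (PiM {t} (\<lambda>_. borel)) (\<lambda>\<omega>. \<lambda>u\<in>{t}. X u \<omega>)
      = distr N (PiM {t} (\<lambda>_. borel)) (\<lambda>\<omega>. \<lambda>u\<in>{t}. Y u \<omega>)"
    using assms(1,2) unfolding same_fdd_def by (elim allE[of _ "{t}"]) simp
  then show ?thesis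
    using distr_one_dim_marginal[of X t M] distr_one_dim_marginal[of Y t N] assms(3,4) by simp
qed

text \<open>Stationarity moves the increment to \<open>X (t - s) - X 0\<close>, the starting value
  vanishes almost surely, and self-similarity with factor \<open>t - s\<close>, read at time
  \<open>1\<close>, produces the scaling.\<close>

lemma increment_distr:
  assumes X: "self_similar M H X" "stationary_increments M X" and st: "0 \<le> s" "s < t"
  shows "distr M borel (\<lambda>\<omega>. X t \<omega> - X s \<omega>) = distr M borel (\<lambda>\<omega>. (t - s) powr H * X 1 \<omega>)"
proof -
  have meas [measurable]: "X u \<in> borel_measurable M" if "u \<ge> 0" for u
    using X(1) that by (simp add: self_similar_def real_process_def)
  note [measurable] = meas[of 0] meas[of 1] meas[of s] meas[of t] meas[of "t - s"]
  have "distr M borel (\<lambda>\<omega>. X t \<omega> - X s \<omega>) = distr M borel (\<lambda>\<omega>. X (t - s) \<omega> - X 0 \<omega>)"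
    using same_fdd_distr_eq[of M "\<lambda>t \<omega>. X (t + s) \<omega> - X s \<omega>" M "\<lambda>t \<omega>. X t \<omega> - X 0 \<omega>" "t - s"] X(2) st
    by (simp add: stationary_increments_def)
  also have "\<dots> = distr M borel (X (t - s))"
    using X(1) st by (intro distr_cong_AE) (auto simp: self_similar_def)
  also have "\<dots> = distr M borel (\<lambda>\<omega>. (t - s) powr H * X 1 \<omega>)"
    using same_fdd_distr_eq[of M "\<lambda>u. X ((t - s) * u)" M "\<lambda>u \<omega>. (t - s) powr H * X u \<omega>" 1] X(1) st
    by (simp add: self_similar_def)
  finally show ?thesis .
qed

text \<open>The path map agrees almost surely with the process, and passing to the completion leaves
  the law of a measurable increment unchanged; so the scaling transfers to the coordinates of the
  path space.\<close>

lemma path_law_increment_distr: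
  assumes X: "self_similar M H X" "stationary_increments M X" "sample_paths_in_C M X I"
    and I: "I \<subseteq> {0..}" and st: "s \<in> I" "t \<in> I" "s < t"
  shows "distr (path_law M I X) borel (\<lambda>f. f t - f s) = distr M borel (\<lambda>\<omega>. (t - s) powr H * X 1 \<omega>)"
proof -
  have proc: "real_process M X"
    using X(1) by (simp add: self_similar_def)
  have [measurable]: "path_map I X \<in> measurable (completion M) (borel_cont_funs I)"
    by (rule measurable_path_map[OF proc I X(3)])
  have [measurable]: "X s \<in> borel_measurable M" "X t \<in> borel_measurable M"
    using proc I st by (auto simp: real_process_def)
  have [measurable]: "(\<lambda>f. f t - f s) \<in> borel_measurable (borel_cont_funs I)"
    using st by measurable
  have "distr (path_law M I X) borel (\<lambda>f. f t - f s)
      = distr (completion M) borel (\<lambda>\<omega>. path_map I X \<omega> t - path_map I X \<omega> s)"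
    unfolding path_law_def by (subst distr_distr) (auto simp: comp_def)
  also have "\<dots> = distr (completion M) borel (\<lambda>\<omega>. X t \<omega> - X s \<omega>)"
  proof (rule distr_cong_AE)
    have "AE \<omega> in completion M. continuous_on I (\<lambda>t. X t \<omega>)"
      using X(3) by (simp add: sample_paths_in_C_def AE_completion)
    then show "AE \<omega> in completion M. path_map I X \<omega> t - path_map I X \<omega> s = X t \<omega> - X s \<omega>"
      by eventually_elim (use st in \<open>simp add: path_map_def\<close>)
    show "(\<lambda>\<omega>. path_map I X \<omega> t - path_map I X \<omega> s) \<in> borel_measurable (completion M)"
      by (rule measurable_compose[where f = "path_map I X"]) measurable
  qed (auto intro: measurable_completion)
  also have "\<dots> = distr M borel (\<lambda>\<omega>. X t \<omega> - X s \<omega>)"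
    by (rule distr_completion) measurable
  also have "\<dots> = distr M borel (\<lambda>\<omega>. (t - s) powr H * X 1 \<omega>)"
    using I st by (intro increment_distr X) auto
  finally show ?thesis .
qed

section \<open>Sums dominated by many small terms\<close>

text \<open>A sum of at most \<open>n * d / 2\<close> forces at least half of the terms to be at
  most \<open>d\<close>. Markov's inequality for the number of such terms uses only its expectation,
  so the dependence between the \<open>Y k\<close> does not matter.\<close>

lemma (in prob_space) prob_sum_abs_le_half:
  fixes Y :: "nat \<Rightarrow> 'a \<Rightarrow> real"
  assumes meas [measurable]: "\<And>k. k < n \<Longrightarrow> Y k \<in> borel_measurable M"
    and "n > 0" "d > 0"
    and p: "\<And>k. k < n \<Longrightarrow> prob {x \<in> space M. \<bar>Y k x\<bar> \<le> d} \<le> p"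
  shows "prob {x \<in> space M. (\<Sum>k<n. \<bar>Y k x\<bar>) \<le> n * d / 2} \<le> 2 * p"
proof -
  define B where "B k = {x \<in> space M. \<bar>Y k x\<bar> \<le> d}" for k
  define N where "N x = (\<Sum>k<n. indicator (B k) x :: real)" for x
  have B: "B k \<in> events" if "k < n" for k
    unfolding B_def using that by measurable
  have N_nonneg: "N x \<ge> 0" for x
    by (simp add: N_def sum_nonneg)
  have int: "integrable M N"
    unfolding N_def using B by (intro Bochner_Integration.integrable_sum integrable_real_indicator)
      (auto simp: less_top[symmetric])
  have "{x \<in> space M. (\<Sum>k<n. \<bar>Y k x\<bar>) \<le> n * d / 2} \<subseteq> {x \<in> space M. N x \<ge> n / 2}"
  proof safe
    fix x assume x: "x \<in> space M" "(\<Sum>k<n. \<bar>Y k x\<bar>) \<le> n * d / 2"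
    \<comment> \<open>\<open>n - N x\<close> counts the terms exceeding \<open>d\<close>, and each
      of them contributes at least \<open>d\<close> to the sum.\<close>
    have "d * (n - N x) = (\<Sum>k<n. d * (1 - indicator (B k) x))"
      by (simp add: N_def sum_subtractf sum_distrib_left[symmetric])
    also have "\<dots> \<le> (\<Sum>k<n. \<bar>Y k x\<bar>)"
      using x(1) by (intro sum_mono) (auto simp: B_def indicator_def)
    finally have "d * (n - N x) \<le> d * (n / 2)"
      using x(2) by (simp add: mult.commute)
    then show "n / 2 \<le> N x"
      using \<open>d > 0\<close> by simp
  qed
  then have "prob {x \<in> space M. (\<Sum>k<n. \<bar>Y k x\<bar>) \<le> n * d / 2} \<le> prob {x \<in> space M. N x \<ge> n / 2}"
    using int by (intro finite_measure_mono) auto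
  also have "\<dots> \<le> expectation N / (n / 2)"
    using int \<open>n > 0\<close> by (intro integral_Markov_inequality_measure[where A = "{}"]) (auto simp: N_nonneg)
  also have "expectation N = (\<Sum>k<n. prob (B k))"
    unfolding N_def using B
    by (subst Bochner_Integration.integral_sum) (auto simp: less_top[symmetric])
  also have "(\<Sum>k<n. prob (B k)) / (n / 2) \<le> (n * p) / (n / 2)"
    using p sum_bounded_above[of "{..<n}" "\<lambda>k. prob (B k)" p] \<open>n > 0\<close>
    by (intro divide_right_mono) (auto simp: B_def)
  also have "\<dots> = 2 * p"
    using \<open>n > 0\<close> by simp
  finally show ?thesis .
qed

section \<open>Dyadic partitions and the separating set\<close>

definition dyadic_point :: "real \<Rightarrow> real \<Rightarrow> nat \<Rightarrow> nat \<Rightarrow> real" where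
  "dyadic_point a b j k = a + real k * ((b - a) / 2 ^ j)"

definition small_variation :: "real set \<Rightarrow> real \<Rightarrow> real \<Rightarrow> real \<Rightarrow> nat \<Rightarrow> (real \<Rightarrow> real) set" where
  "small_variation I a b \<gamma> j = {f \<in> cont_funs I.
     (\<Sum>k<2 ^ j. \<bar>f (dyadic_point a b j (Suc k)) - f (dyadic_point a b j k)\<bar>)
       \<le> real (2 ^ j) * ((b - a) / 2 ^ j) powr \<gamma> / 2}"

lemma dyadic_point_in:
  assumes "a < b" "k \<le> 2 ^ j"
  shows "dyadic_point a b j k \<in> {a..b}"
proof -
  have "real k \<le> 2 ^ j"
    using assms(2) by (metis of_nat_le_iff of_nat_numeral of_nat_power)
  then have "real k * (b - a) \<le> 2 ^ j * (b - a)"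
    using assms(1) by (intro mult_right_mono) auto
  then have "real k * (b - a) / 2 ^ j \<le> b - a"
    by (simp add: pos_divide_le_eq mult.commute)
  then show ?thesis
    using assms(1) by (simp add: dyadic_point_def)
qed

lemma dyadic_point_Suc: "dyadic_point a b j (Suc k) - dyadic_point a b j k = (b - a) / 2 ^ j"
  by (simp add: dyadic_point_def distrib_right add_divide_distrib)

text \<open>Exhibits powers of the step as a geometric sequence in \<open>j\<close>. For
  \<open>c > 0\<close> the ratio is below \<open>1\<close>, which gives both the convergence to
  \<open>0\<close> and the summability used later.\<close>

lemma dyadic_step_powr:
  fixes a b c :: real
  shows "((b - a) / 2 ^ j) powr c = (b - a) powr c * (2 powr - c) ^ j"
proof -
  have "(2 ^ j) powr c = (2 powr c) ^ j"
    by (simp add: powr_realpow[symmetric] powr_powr mult.commute)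
  moreover have "((b - a) / 2 ^ j) powr c = (b - a) powr c / (2 ^ j) powr c"
    by (rule powr_divide)
  ultimately show ?thesis
    by (simp add: powr_minus divide_inverse power_inverse)
qed

text \<open>The limit inferior of the sets \<open>small_variation I a b \<gamma> j\<close>; this
  set, or its complement, separates the two laws.\<close>

definition eventually_small_variation :: "real set \<Rightarrow> real \<Rightarrow> real \<Rightarrow> real \<Rightarrow> (real \<Rightarrow> real) set" where
  "eventually_small_variation I a b \<gamma> =
     {f \<in> cont_funs I. eventually (\<lambda>j. f \<in> small_variation I a b \<gamma> j) sequentially}"

section \<open>Small variation under the law of a single process\<close>

context
  fixes M :: "'a measure" and X :: "real \<Rightarrow> 'a \<Rightarrow> real" and H a b :: real and I :: "real set"
  assumes X: "self_similar M H X" "stationary_increments M X" "sample_paths_in_C M X I"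
    and I: "I \<subseteq> {0..}" and ab: "a < b" "{a..b} \<subseteq> I"
begin

interpretation P: prob_space "path_law M I X"
  using X I by (intro prob_space_path_law) (simp_all add: self_similar_def)

interpretation M: prob_space M
  using X by (simp add: self_similar_def real_process_def)

lemma X1_measurable [measurable]: "X 1 \<in> borel_measurable M"
  using X by (simp add: self_similar_def real_process_def)

lemma eval_path_law_measurable:
  assumes "k \<le> 2 ^ j"
  shows "(\<lambda>f. f (dyadic_point a b j k)) \<in> borel_measurable (path_law M I X)"
proof -
  have "dyadic_point a b j k \<in> I"
    using dyadic_point_in[OF ab(1) assms] ab(2) by blast
  then show ?thesis
    by (simp add: path_law_def borel_measurable_eval)
qed

lemma increment_measurable:
  assumes "k < 2 ^ j"
  shows "(\<lambda>f. f (dyadic_point a b j (Suc k)) - f (dyadic_point a b j k)) \<in> borel_measurable (path_law M I X)"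
  using assms by (intro borel_measurable_diff eval_path_law_measurable) auto

lemma small_variation_sets: "small_variation I a b \<gamma> j \<in> P.events"
proof -
  have [measurable]: "(\<lambda>f. \<Sum>k<2 ^ j. \<bar>f (dyadic_point a b j (Suc k)) - f (dyadic_point a b j k)\<bar>)
      \<in> borel_measurable (path_law M I X)"
    by (intro borel_measurable_sum borel_measurable_abs increment_measurable) auto
  show ?thesis
    unfolding small_variation_def space_path_law[of M I X, symmetric] by measurable
qed

lemma dyadic_increment_distr:
  assumes "k < 2 ^ j"
  shows "distr (path_law M I X) borel (\<lambda>f. f (dyadic_point a b j (Suc k)) - f (dyadic_point a b j k))
    = distr M borel (\<lambda>\<omega>. ((b - a) / 2 ^ j) powr H * X 1 \<omega>)"
proof -
  have "dyadic_point a b j k \<in> I" "dyadic_point a b j (Suc k) \<in> I"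
    using dyadic_point_in[OF ab(1)] ab(2) assms by (meson Suc_leI less_imp_le_nat subsetD)+
  moreover have "dyadic_point a b j k < dyadic_point a b j (Suc k)"
    using ab(1) by (simp add: dyadic_point_def divide_strict_right_mono)
  ultimately show ?thesis
    using path_law_increment_distr[OF X I] by (simp add: dyadic_point_Suc)
qed

text \<open>Each increment has the law of \<open>h powr H * X 1\<close>, so after division by
  \<open>h powr H\<close> the probability that it is at most \<open>h powr \<gamma>\<close> in
  absolute value is the same for all \<open>k\<close>. The counting bound applies with
  \<open>d = h powr \<gamma>\<close> and \<open>2 ^ j\<close> terms.\<close>

lemma prob_small_variation_le:
  "P.prob (small_variation I a b \<gamma> j)
    \<le> 2 * M.prob {\<omega> \<in> space M. \<bar>X 1 \<omega>\<bar> \<le> ((b - a) / 2 ^ j) powr (\<gamma> - H)}"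
proof -
  define h where "h = (b - a) / 2 ^ j"
  have h: "h > 0"
    using ab by (simp add: h_def)
  define Y where "Y k f = f (dyadic_point a b j (Suc k)) - f (dyadic_point a b j k)"
    for k and f :: "real \<Rightarrow> real"
  have Y [measurable]: "Y k \<in> borel_measurable (path_law M I X)" if "k < 2 ^ j" for k
    unfolding Y_def using that by (rule increment_measurable)
  have "P.prob {f \<in> space (path_law M I X). \<bar>Y k f\<bar> \<le> h powr \<gamma>}
      = M.prob {\<omega> \<in> space M. \<bar>X 1 \<omega>\<bar> \<le> h powr (\<gamma> - H)}" if k: "k < 2 ^ j" for k
  proof -
    have "P.prob {f \<in> space (path_law M I X). \<bar>Y k f\<bar> \<le> h powr \<gamma>}
        = measure (distr (path_law M I X) borel (Y k)) {x. \<bar>x\<bar> \<le> h powr \<gamma>}"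
      using Y[OF k] by (subst measure_distr) (auto simp: Int_def vimage_def conj_commute)
    also have "distr (path_law M I X) borel (Y k) = distr M borel (\<lambda>\<omega>. h powr H * X 1 \<omega>)"
      unfolding Y_def h_def using k by (rule dyadic_increment_distr)
    also have "measure \<dots> {x. \<bar>x\<bar> \<le> h powr \<gamma>} = M.prob {\<omega> \<in> space M. \<bar>h powr H * X 1 \<omega>\<bar> \<le> h powr \<gamma>}"
      by (subst measure_distr) (auto simp: Int_def vimage_def conj_commute)
    also have "\<dots> = M.prob {\<omega> \<in> space M. \<bar>X 1 \<omega>\<bar> \<le> h powr (\<gamma> - H)}"
      using h by (simp add: abs_mult powr_diff pos_le_divide_eq mult.commute)
    finally show ?thesis .
  qed
  then have "P.prob {f \<in> space (path_law M I X). (\<Sum>k<2 ^ j. \<bar>Y k f\<bar>) \<le> real (2 ^ j) * h powr \<gamma> / 2}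
      \<le> 2 * M.prob {\<omega> \<in> space M. \<bar>X 1 \<omega>\<bar> \<le> h powr (\<gamma> - H)}"
    using h by (intro P.prob_sum_abs_le_half Y) auto
  then show ?thesis
    by (simp add: small_variation_def space_path_law Y_def h_def)
qed

text \<open>As \<open>\<gamma> - H > 0\<close>, the radii \<open>r j\<close> decrease to
  \<open>0\<close>, so the events \<open>A j\<close> shrink to the event \<open>X 1 = 0\<close>.
  Continuity from above and the missing atom give the limit.\<close>

lemma prob_small_variation_tendsto_0:
  assumes "H < \<gamma>" and atom: "measure (distr M borel (X 1)) {0} = 0"
  shows "(\<lambda>j. P.prob (small_variation I a b \<gamma> j)) \<longlonglongrightarrow> 0"
proof -
  define r where "r j = ((b - a) / 2 ^ j) powr (\<gamma> - H)" for j :: nat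
  define A where "A j = {\<omega> \<in> space M. \<bar>X 1 \<omega>\<bar> \<le> r j}" for j
  have "2 powr - (\<gamma> - H) < 2 powr 0"
    using assms(1) by (intro powr_less_mono) auto
  then have "(\<lambda>j. (b - a) powr (\<gamma> - H) * (2 powr - (\<gamma> - H)) ^ j) \<longlonglongrightarrow> (b - a) powr (\<gamma> - H) * 0"
    by (intro tendsto_mult_left LIMSEQ_power_zero) simp
  then have r0: "r \<longlonglongrightarrow> 0"
    unfolding r_def dyadic_step_powr by simp
  have "decseq r"
    unfolding r_def using ab(1) assms(1)
    by (intro decseq_SucI powr_mono2) (auto simp: field_simps)
  then have "decseq A"
    by (auto simp: A_def decseq_def intro: order_trans)
  moreover have "range A \<subseteq> M.events"
    by (auto simp: A_def)
  ultimately have "(\<lambda>j. M.prob (A j)) \<longlonglongrightarrow> M.prob (\<Inter>j. A j)"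
    by (intro M.finite_Lim_measure_decseq)
  also have "(\<Inter>j. A j) = {\<omega> \<in> space M. X 1 \<omega> = 0}"
  proof -
    have "x = 0" if "\<And>j. \<bar>x\<bar> \<le> r j" for x
      using LIMSEQ_le_const[OF r0, of "\<bar>x\<bar>"] that by auto
    moreover have "r j \<ge> 0" for j
      by (simp add: r_def)
    ultimately show ?thesis
      unfolding A_def by (intro equalityI subsetI) (simp_all add: INT_iff)
  qed
  also have "M.prob \<dots> = 0"
    using atom by (subst (asm) measure_distr) (auto simp: Int_def vimage_def conj_commute)
  finally have lim: "(\<lambda>j. 2 * M.prob (A j)) \<longlonglongrightarrow> 0"
    by (rule tendsto_mult_right_zero)
  have "P.prob (small_variation I a b \<gamma> j) \<le> 2 * M.prob (A j)" for j
    unfolding A_def r_def by (rule prob_small_variation_le)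
  then show ?thesis
    by (intro tendsto_sandwich[OF _ _ tendsto_const lim] always_eventually allI measure_nonneg)
qed

text \<open>Markov's inequality for the total variation \<open>V\<close> over the partition: the
  number \<open>2 ^ j\<close> of pieces cancels between the expectation and the threshold
  \<open>c\<close>, and the half in \<open>c\<close> becomes the factor \<open>2\<close>.\<close>

lemma prob_not_small_variation_le:
  assumes "integrable M (X 1)"
  shows "P.prob (cont_funs I - small_variation I a b \<gamma> j)
    \<le> 2 * M.expectation (\<lambda>\<omega>. \<bar>X 1 \<omega>\<bar>) * ((b - a) / 2 ^ j) powr (H - \<gamma>)"
proof -
  define h where "h = (b - a) / 2 ^ j"
  have h: "h > 0"
    using ab by (simp add: h_def)
  define Y where "Y k f = f (dyadic_point a b j (Suc k)) - f (dyadic_point a b j k)"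
    for k and f :: "real \<Rightarrow> real"
  define V where "V f = (\<Sum>k<2 ^ j. \<bar>Y k f\<bar>)" for f
  define c where "c = real (2 ^ j) * h powr \<gamma> / 2"
  have Y [measurable]: "Y k \<in> borel_measurable (path_law M I X)" if "k < 2 ^ j" for k
    unfolding Y_def using that by (rule increment_measurable)
  have distr_Y: "distr (path_law M I X) borel (Y k) = distr M borel (\<lambda>\<omega>. h powr H * X 1 \<omega>)"
    if "k < 2 ^ j" for k
    unfolding Y_def h_def using that by (rule dyadic_increment_distr)
  have int_Y: "integrable (path_law M I X) (\<lambda>f. \<bar>Y k f\<bar>)" if k: "k < 2 ^ j" for k
  proof -
    \<comment> \<open>Integrability depends only on the law, so it is carried from
      \<open>X 1\<close> to the increment through their common distribution.\<close>
    have "integrable (distr M borel (\<lambda>\<omega>. h powr H * X 1 \<omega>)) abs"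
      using assms by (subst integrable_distr_eq) (auto simp: abs_mult)
    then show ?thesis
      unfolding distr_Y[OF k, symmetric] using Y[OF k] by (subst (asm) integrable_distr_eq) auto
  qed
  have "P.expectation (\<lambda>f. \<bar>Y k f\<bar>) = h powr H * M.expectation (\<lambda>\<omega>. \<bar>X 1 \<omega>\<bar>)" if k: "k < 2 ^ j" for k
  proof -
    have "P.expectation (\<lambda>f. \<bar>Y k f\<bar>) = integral\<^sup>L (distr (path_law M I X) borel (Y k)) abs"
      using Y[OF k] by (subst integral_distr) auto
    also have "\<dots> = h powr H * M.expectation (\<lambda>\<omega>. \<bar>X 1 \<omega>\<bar>)"
      unfolding distr_Y[OF k] by (subst integral_distr) (auto simp: abs_mult)
    finally show ?thesis .
  qed
  then have exp_V: "P.expectation V = real (2 ^ j) * (h powr H * M.expectation (\<lambda>\<omega>. \<bar>X 1 \<omega>\<bar>))"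
    unfolding V_def using int_Y by (subst Bochner_Integration.integral_sum) auto
  have V_nonneg: "V f \<ge> 0" for f
    by (simp add: V_def sum_nonneg)
  have int_V: "integrable (path_law M I X) V"
    unfolding V_def using int_Y by (intro Bochner_Integration.integrable_sum) auto
  have "P.prob (cont_funs I - small_variation I a b \<gamma> j) \<le> P.prob {f \<in> space (path_law M I X). V f \<ge> c}"
  proof (rule P.finite_measure_mono)
    show "cont_funs I - small_variation I a b \<gamma> j \<subseteq> {f \<in> space (path_law M I X). V f \<ge> c}"
      unfolding small_variation_def space_path_law V_def Y_def c_def h_def by fastforce
    have [measurable]: "V \<in> borel_measurable (path_law M I X)"
      using int_V by (rule borel_measurable_integrable)
    show "{f \<in> space (path_law M I X). V f \<ge> c} \<in> P.events"
      by measurable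
  qed
  also have "\<dots> \<le> P.expectation V / c"
    using int_V h by (intro integral_Markov_inequality_measure[where A = "{}"])
      (auto simp: V_nonneg c_def)
  also have "\<dots> = 2 * M.expectation (\<lambda>\<omega>. \<bar>X 1 \<omega>\<bar>) * h powr (H - \<gamma>)"
    unfolding exp_V c_def using h by (simp add: powr_diff)
  finally show ?thesis
    by (simp add: h_def)
qed

text \<open>The failure probabilities are dominated by a geometric series of ratio
  \<open>2 powr - (H - \<gamma>) < 1\<close>, so the first Borel-Cantelli lemma applies.\<close>

lemma AE_eventually_small_variation:
  assumes "\<gamma> < H" and "integrable M (X 1)"
  shows "AE f in path_law M I X. eventually (\<lambda>j. f \<in> small_variation I a b \<gamma> j) sequentially"
proof -
  define A where "A j = cont_funs I - small_variation I a b \<gamma> j" for j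
  define C where "C = 2 * M.expectation (\<lambda>\<omega>. \<bar>X 1 \<omega>\<bar>) * (b - a) powr (H - \<gamma>)"
  have "2 powr - (H - \<gamma>) < 2 powr 0"
    using assms(1) by (intro powr_less_mono) auto
  then have geometric: "summable (\<lambda>j. C * (2 powr - (H - \<gamma>)) ^ j)"
    by (intro summable_mult summable_geometric) simp
  have "P.prob (A j) \<le> C * (2 powr - (H - \<gamma>)) ^ j" for j
    using prob_not_small_variation_le[OF assms(2), of \<gamma> j]
    unfolding A_def C_def dyadic_step_powr by (simp add: mult.assoc)
  then have "summable (\<lambda>j. P.prob (A j))"
    by (intro summable_comparison_test'[OF geometric, of 0])
      (simp only: real_norm_def abs_of_nonneg measure_nonneg)
  moreover have "A j \<in> P.events" for j
    unfolding A_def space_path_law[of M I X, symmetric] using small_variation_sets by auto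
  ultimately have "AE f in path_law M I X. eventually (\<lambda>j. f \<in> space (path_law M I X) - A j) sequentially"
    by (intro borel_cantelli_AE1) (auto simp: less_top[symmetric])
  then show ?thesis
    by eventually_elim (auto elim!: eventually_mono simp: A_def space_path_law)
qed

lemma eventually_small_variation_sets: "eventually_small_variation I a b \<gamma> \<in> P.events"
proof -
  have [measurable]: "small_variation I a b \<gamma> j \<in> P.events" for j
    by (rule small_variation_sets)
  show ?thesis
    unfolding eventually_small_variation_def eventually_sequentially space_path_law[of M I X, symmetric]
    by measurable
qed

lemma emeasure_eventually_small_variation_1:
  assumes "\<gamma> < H" and "integrable M (X 1)"
  shows "emeasure (path_law M I X) (eventually_small_variation I a b \<gamma>) = 1"
proof (rule P.emeasure_eq_1_AE[OF eventually_small_variation_sets])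
  show "AE f in path_law M I X. f \<in> eventually_small_variation I a b \<gamma>"
    using AE_eventually_small_variation[OF assms] AE_space
    by eventually_elim (simp add: eventually_small_variation_def space_path_law)
qed

text \<open>The limit inferior is the countable union of the tail intersections \<open>B N\<close>.
  Each \<open>B N\<close> lies in all later small-variation sets, whose probabilities tend to
  \<open>0\<close>, and is therefore null.\<close>

lemma emeasure_eventually_small_variation_0:
  assumes "H < \<gamma>" and atom: "measure (distr M borel (X 1)) {0} = 0"
  shows "emeasure (path_law M I X) (eventually_small_variation I a b \<gamma>) = 0"
proof -
  define B where "B N = (\<Inter>j\<in>{N..}. small_variation I a b \<gamma> j)" for N :: nat
  have B: "B N \<in> P.events" for N
    unfolding B_def using small_variation_sets by (intro sets.countable_INT) auto
  have "P.prob (B N) \<le> 0" for N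
  proof (rule LIMSEQ_le_const[OF prob_small_variation_tendsto_0[OF assms]], intro exI allI impI)
    show "P.prob (B N) \<le> P.prob (small_variation I a b \<gamma> j)" if "N \<le> j" for j
      using that small_variation_sets by (intro P.finite_measure_mono) (auto simp: B_def)
  qed
  then have "B N \<in> null_sets (path_law M I X)" for N
    using B by (intro null_setsI) (auto simp: P.emeasure_eq_measure order_antisym)
  then have "(\<Union>N. B N) \<in> null_sets (path_law M I X)"
    by (rule null_sets_UN)
  moreover have "eventually_small_variation I a b \<gamma> = (\<Union>N. B N)"
    by (auto simp: eventually_small_variation_def eventually_sequentially B_def small_variation_def)
  ultimately show ?thesis
    by auto
qed

end

section \<open>Separation of the two laws\<close>

theorem theorem3p5:
  fixes I :: "real set"
    and M1 :: "'a measure" and M2 :: "'b measure"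
    and X1 :: "real \<Rightarrow> 'a \<Rightarrow> real" and X2 :: "real \<Rightarrow> 'b \<Rightarrow> real"
    and H1 H2 :: real
  assumes "is_interval I" and "closed I" and "I \<subseteq> {0..}"
    and "\<exists>a\<in>I. \<exists>b\<in>I. a < b"
    and "0 < H1" and "H1 < 1" and "0 < H2" and "H2 < 1"
    and "self_similar M1 H1 X1" and "self_similar M2 H2 X2"
    and "stationary_increments M1 X1" and "stationary_increments M2 X2"
    and "finite_absolute_moment M1 X1" and "finite_absolute_moment M2 X2"
    and "sample_paths_in_C M1 X1 I" and "sample_paths_in_C M2 X2 I"
    and "measure (distr M1 borel (X1 1)) {0} = 0"
    and "measure (distr M2 borel (X2 1)) {0} = 0"
    and "H1 \<noteq> H2"
  shows "singular_on I M1 X1 M2 X2"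
proof -
  obtain a b where ab: "a \<in> I" "b \<in> I" "a < b"
    using assms(4) by blast
  have abI: "{a..b} \<subseteq> I"
    using assms(1) ab mem_is_interval_1_I[of I a b] by auto
  have int: "integrable M1 (X1 1)" "integrable M2 (X2 1)"
    using assms(13,14) by (simp_all add: finite_absolute_moment_def)
  \<comment> \<open>The midpoint serves as a value strictly between the two parameters.\<close>
  define \<gamma> where "\<gamma> = (H1 + H2) / 2"
  define A where "A = eventually_small_variation I a b \<gamma>"
  note X1 = assms(9,11,15,3) ab(3) abI
  note X2 = assms(10,12,16,3) ab(3) abI
  have A: "A \<in> sets (borel_cont_funs I)"
    using eventually_small_variation_sets[OF X1, of \<gamma>] by (simp add: A_def path_law_def)
  show ?thesis
  proof (cases "H1 < H2")
    case False
    then have "\<gamma> < H1" "H2 < \<gamma>"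
      using assms(19) by (auto simp: \<gamma>_def)
    then have "emeasure (path_law M1 I X1) A = 1" "emeasure (path_law M2 I X2) A = 0"
      using emeasure_eventually_small_variation_1[OF X1 _ int(1)]
        emeasure_eventually_small_variation_0[OF X2 _ assms(18)] by (simp_all add: A_def)
    then show ?thesis
      using A unfolding singular_on_def by blast
  next
    \<comment> \<open>Here the second process is the smoother one, so \<open>A\<close> has full mass
      under the second law and none under the first. The definition of singularity asks for mass
      \<open>1\<close> under the first law, hence the complement of \<open>A\<close> is the
      witness.\<close>
    case True
    then have \<gamma>: "\<gamma> < H2" "H1 < \<gamma>"
      by (auto simp: \<gamma>_def)
    interpret P1: prob_space "path_law M1 I X1"
      using assms(3,9,15) by (intro prob_space_path_law) (simp_all add: self_similar_def)
    interpret P2: prob_space "path_law M2 I X2"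
      using assms(3,10,16) by (intro prob_space_path_law) (simp_all add: self_similar_def)
    have "emeasure (path_law M2 I X2) A = 1" "emeasure (path_law M1 I X1) A = 0"
      using emeasure_eventually_small_variation_1[OF X2 \<gamma>(1) int(2)]
        emeasure_eventually_small_variation_0[OF X1 \<gamma>(2) assms(17)] by (simp_all add: A_def)
    moreover have "A \<in> P1.events" "A \<in> P2.events"
      using A by (simp_all add: path_law_def)
    ultimately have "emeasure (path_law M1 I X1) (space (borel_cont_funs I) - A) = 1"
      "emeasure (path_law M2 I X2) (space (borel_cont_funs I) - A) = 0"
      using P1.prob_compl[of A] P2.prob_compl[of A]
      by (simp_all add: P1.emeasure_eq_measure P2.emeasure_eq_measure space_path_law space_borel_cont_funs)
    then show ?thesis
      using A unfolding singular_on_def by blast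
  qed
qed

end
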